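(* Let $F$ be an algebraically closed field of characteristic zero, $G$ a finite abelian group, and let $R$ be a simple algebra with minimal one-sided ideals over $F$, i.e. $R\cong V\otimes\Pi$ for a pair of mutually dual $F$-vector spaces $V$ and $\Pi\subset V^{*}$. Suppose $R$ is given a $G$-grading. Then $R$ has a local system of graded finite-dimensional matrix algebras.
   Context: A $G$-grading on an algebra $R$ is a vector space decomposition $R=\bigoplus_{g\in G}R^{(g)}$ with $R^{(g)}R^{(h)}\subset R^{(gh)}$ for all $g,h\in G$; a subalgebra $W\subset R$ is graded if $W=\bigoplus_g (W\cap R^{(g)})$. A pair of mutually dual spaces consists of a nonzero $F$-vector space $V$ and a subspace $\Pi$ of the dual space $V^{*}$ such that the bilinear pairing $V\times\Pi\to F$, $(v,\pi)\mapsto\pi(v)$, is nondegenerate. The vector space $V\otimes\Pi$ (tensor product over $F$) is an associative algebra with product determined by $(v_1\otimes\pi_1)(v_2\otimes\pi_2)=\pi_1(v_2)(v_1\otimes\pi_2)$. A local system of subalgebras of $R$ is a family $\{R_\alpha\mid\alpha\in I\}$ of subalgebras, indexed by a directed set $I$, such that $R=\bigcup_{\alpha\in I}R_\alpha$ and for any $\alpha,\beta\in I$ there is $\gamma\in I$ with $R_\alpha\subset R_\gamma$ and $R_\beta\subset R_\gamma$. A finite-dimensional matrix algebra is an algebra isomorphic to $M_n(F)$ for some $n\ge 1$; the members of the local system need not contain an identity element of $R$. *)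

theory Defs
  imports
    "HOL-Computational_Algebra.Polynomial"
    "HOL-Library.Function_Algebras"
    "HOL-Library.Poly_Mapping"
    "Jordan_Normal_Form.Matrix"
begin

section \<open>Algebras\<close>

text \<open>Algebras are associative and need not have an identity element: the class \<open>ring\<close>
  does not include a unit.\<close>

locale assoc_algebra = vector_space scale
  for scale :: "'f::field \<Rightarrow> 'r::ring \<Rightarrow> 'r" +
  assumes scale_mult_left: "scale c x * y = scale c (x * y)"
    and scale_mult_right: "x * scale c y = scale c (x * y)"

definition subalgebra :: "('f::field \<Rightarrow> 'r::ring \<Rightarrow> 'r) \<Rightarrow> 'r set \<Rightarrow> bool" where
  "subalgebra scale W \<longleftrightarrow>
     module.subspace scale W \<and> (\<forall>x\<in>W. \<forall>y\<in>W. x * y \<in> W)"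

text \<open>Operations on an explicit carrier set, so that algebras on subsets of a type, on matrices and
  on cosets can be compared; no axioms are attached to the record.\<close>

record ('f, 'a) algebra_struct =
  alg_carrier :: "'a set"
  alg_add :: "'a \<Rightarrow> 'a \<Rightarrow> 'a"
  alg_mult :: "'a \<Rightarrow> 'a \<Rightarrow> 'a"
  alg_scale :: "'f \<Rightarrow> 'a \<Rightarrow> 'a"

definition alg_isomorphic :: "('f, 'a) algebra_struct \<Rightarrow> ('f, 'b) algebra_struct \<Rightarrow> bool" where
  "alg_isomorphic A B \<longleftrightarrow>
     (\<exists>\<phi>. bij_betw \<phi> (alg_carrier A) (alg_carrier B) \<and>
        (\<forall>x\<in>alg_carrier A. \<forall>y\<in>alg_carrier A.
           \<phi> (alg_add A x y) = alg_add B (\<phi> x) (\<phi> y) \<and>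
           \<phi> (alg_mult A x y) = alg_mult B (\<phi> x) (\<phi> y)) \<and>
        (\<forall>c. \<forall>x\<in>alg_carrier A. \<phi> (alg_scale A c x) = alg_scale B c (\<phi> x)))"

definition alg_on :: "('f \<Rightarrow> 'r::ring \<Rightarrow> 'r) \<Rightarrow> 'r set \<Rightarrow> ('f, 'r) algebra_struct" where
  "alg_on scale W =
     \<lparr>alg_carrier = W, alg_add = (+), alg_mult = (*), alg_scale = scale\<rparr>"

definition mat_alg :: "nat \<Rightarrow> ('f::field, 'f mat) algebra_struct" where
  "mat_alg n =
     \<lparr>alg_carrier = carrier_mat n n, alg_add = (+), alg_mult = (*), alg_scale = smult_mat\<rparr>"

definition fd_matrix_algebra :: "('f::field \<Rightarrow> 'r::ring \<Rightarrow> 'r) \<Rightarrow> 'r set \<Rightarrow> bool" where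
  "fd_matrix_algebra scale W \<longleftrightarrow>
     (\<exists>n\<ge>1. alg_isomorphic (alg_on scale W) (mat_alg n :: ('f, 'f mat) algebra_struct))"


section \<open>Gradings by a finite abelian group, written additively\<close>

text \<open>The index type is finite, so families of components need no finite support condition.\<close>

definition internal_direct_sum ::
    "('f::field \<Rightarrow> 'r::ab_group_add \<Rightarrow> 'r) \<Rightarrow> 'r set \<Rightarrow> ('g::finite \<Rightarrow> 'r set) \<Rightarrow> bool" where
  "internal_direct_sum scale W A \<longleftrightarrow>
     (\<forall>g. module.subspace scale (A g) \<and> A g \<subseteq> W) \<and>
     (\<forall>w\<in>W. \<exists>!f. (\<forall>g. f g \<in> A g) \<and> w = (\<Sum>g\<in>UNIV. f g))"

definition grading ::
    "('f::field \<Rightarrow> 'r::ring \<Rightarrow> 'r) \<Rightarrow> ('g::{ab_group_add, finite} \<Rightarrow> 'r set) \<Rightarrow> bool" where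
  "grading scale A \<longleftrightarrow>
     internal_direct_sum scale UNIV A \<and>
     (\<forall>g h. \<forall>x\<in>A g. \<forall>y\<in>A h. x * y \<in> A (g + h))"

definition graded_subalgebra ::
    "('f::field \<Rightarrow> 'r::ring \<Rightarrow> 'r) \<Rightarrow> ('g::{ab_group_add, finite} \<Rightarrow> 'r set) \<Rightarrow> 'r set \<Rightarrow> bool"
  where
  "graded_subalgebra scale A W \<longleftrightarrow>
     subalgebra scale W \<and> internal_direct_sum scale W (\<lambda>g. W \<inter> A g)"


section \<open>Local systems\<close>

definition directed_set :: "'i set \<Rightarrow> ('i \<Rightarrow> 'i \<Rightarrow> bool) \<Rightarrow> bool" where
  "directed_set I leq \<longleftrightarrow>
     I \<noteq> {} \<and>
     (\<forall>a\<in>I. leq a a) \<and>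
     (\<forall>a\<in>I. \<forall>b\<in>I. \<forall>c\<in>I. leq a b \<longrightarrow> leq b c \<longrightarrow> leq a c) \<and>
     (\<forall>a\<in>I. \<forall>b\<in>I. \<exists>c\<in>I. leq a c \<and> leq b c)"

definition local_system ::
    "('f::field \<Rightarrow> 'r::ring \<Rightarrow> 'r) \<Rightarrow> 'i set \<Rightarrow> ('i \<Rightarrow> 'i \<Rightarrow> bool) \<Rightarrow> ('i \<Rightarrow> 'r set) \<Rightarrow> bool"
  where
  "local_system scale I leq S \<longleftrightarrow>
     directed_set I leq \<and>
     (\<forall>a\<in>I. subalgebra scale (S a)) \<and>
     (\<Union>a\<in>I. S a) = UNIV \<and>
     (\<forall>a\<in>I. \<forall>b\<in>I. \<exists>c\<in>I. S a \<subseteq> S c \<and> S b \<subseteq> S c)"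


section \<open>Mutually dual spaces and the algebra on their tensor product\<close>

definition dual_space :: "('f::field \<Rightarrow> 'v::ab_group_add \<Rightarrow> 'v) \<Rightarrow> ('v \<Rightarrow> 'f) set" where
  "dual_space scale = {p. Vector_Spaces.linear scale (*) p}"

definition dual_scale :: "'f::field \<Rightarrow> ('v \<Rightarrow> 'f) \<Rightarrow> 'v \<Rightarrow> 'f" where
  "dual_scale c p = (\<lambda>v. c * p v)"

definition mutually_dual_spaces ::
    "('f::field \<Rightarrow> 'v::ab_group_add \<Rightarrow> 'v) \<Rightarrow> ('v \<Rightarrow> 'f) set \<Rightarrow> bool" where
  "mutually_dual_spaces scale P \<longleftrightarrow>
     vector_space scale \<and> (\<exists>v::'v. v \<noteq> 0) \<and>
     P \<subseteq> dual_space scale \<and> module.subspace dual_scale P \<and>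
     (\<forall>v. (\<forall>p\<in>P. p v = 0) \<longrightarrow> v = 0) \<and>
     (\<forall>p\<in>P. (\<forall>v. p v = 0) \<longrightarrow> p = 0)"

text \<open>The tensor product of \<open>V\<close> and \<open>P\<close> is the vector space with basis \<open>V \<times> P\<close>, whose elements
  are the finitely supported functions on \<open>V \<times> P\<close>, modulo the span of the bilinearity relations.
  The relations involve \<open>P\<close>, so the elements of the quotient are cosets rather than the
  elements of a new type.\<close>

type_synonym ('f, 'v) free_sp = "('v \<times> ('v \<Rightarrow> 'f)) \<Rightarrow>\<^sub>0 'f"

definition free_space :: "('v \<Rightarrow> 'f::field) set \<Rightarrow> ('f, 'v) free_sp set" where
  "free_space P = {x. Poly_Mapping.keys x \<subseteq> UNIV \<times> P}"

definition free_scale :: "'f::field \<Rightarrow> ('f, 'v) free_sp \<Rightarrow> ('f, 'v) free_sp" where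
  "free_scale c x = Poly_Mapping.map ((*) c) x"

abbreviation free_gen :: "'v \<Rightarrow> ('v \<Rightarrow> 'f::field) \<Rightarrow> ('f, 'v) free_sp" where
  "free_gen v p \<equiv> Poly_Mapping.single (v, p) 1"

text \<open>Bilinear extension of \<open>(v, p) (w, q) = p w (v, q)\<close>.\<close>

definition free_mult :: "('f::field, 'v) free_sp \<Rightarrow> ('f, 'v) free_sp \<Rightarrow> ('f, 'v) free_sp" where
  "free_mult x y =
     (\<Sum>(v, p)\<in>Poly_Mapping.keys x. \<Sum>(w, q)\<in>Poly_Mapping.keys y.
        free_scale (Poly_Mapping.lookup x (v, p) * Poly_Mapping.lookup y (w, q) * p w)
          (free_gen v q))"

definition bilin_relations ::
    "('f::field \<Rightarrow> 'v::ab_group_add \<Rightarrow> 'v) \<Rightarrow> ('v \<Rightarrow> 'f) set \<Rightarrow> ('f, 'v) free_sp set" where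
  "bilin_relations scale P =
     {free_gen (v + w) p - free_gen v p - free_gen w p | v w p. p \<in> P} \<union>
     {free_gen v (p + q) - free_gen v p - free_gen v q | v p q. p \<in> P \<and> q \<in> P} \<union>
     {free_gen (scale c v) p - free_scale c (free_gen v p) | c v p. p \<in> P} \<union>
     {free_gen v (dual_scale c p) - free_scale c (free_gen v p) | c v p. p \<in> P}"

definition tensor_class ::
    "('f::field \<Rightarrow> 'v::ab_group_add \<Rightarrow> 'v) \<Rightarrow> ('v \<Rightarrow> 'f) set \<Rightarrow>
     ('f, 'v) free_sp \<Rightarrow> ('f, 'v) free_sp set" where
  "tensor_class scale P x = {y. y - x \<in> module.span free_scale (bilin_relations scale P)}"

text \<open>The operations are induced by those on representatives; on a pair of mutually dual spaces
  the results do not depend on the representatives, so each union below is a single coset.\<close>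

definition tensor_alg ::
    "('f::field \<Rightarrow> 'v::ab_group_add \<Rightarrow> 'v) \<Rightarrow> ('v \<Rightarrow> 'f) set \<Rightarrow>
     ('f, ('f, 'v) free_sp set) algebra_struct" where
  "tensor_alg scale P =
     \<lparr>alg_carrier = tensor_class scale P ` free_space P,
      alg_add = (\<lambda>X Y. \<Union>x\<in>X. \<Union>y\<in>Y. tensor_class scale P (x + y)),
      alg_mult = (\<lambda>X Y. \<Union>x\<in>X. \<Union>y\<in>Y. tensor_class scale P (free_mult x y)),
      alg_scale = (\<lambda>c X. \<Union>x\<in>X. tensor_class scale P (free_scale c x))\<rparr>"

end

theory Submission
  imports Defs
begin

section \<open>Homogeneous local units in graded regular rings\<close>

text \<open>The algebra acts faithfully on \<open>V\<close> by finite-rank operators, and every such operator \<open>x\<close> has a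
  quasi-inverse, \<open>x y x = x\<close>. In a regular ring a finitely generated right ideal is \<open>f R\<close> with \<open>f\<close>
  idempotent; if it is generated by homogeneous elements, the degree-zero component of \<open>f\<close> is again
  an idempotent generator. Combining left and right versions, any finite set of homogeneous elements has
  a two-sided identity \<open>e\<close> that is an idempotent of degree zero. The corner \<open>e R e\<close> is then graded,
  because multiplication by \<open>e\<close> preserves degrees, and it is the full matrix algebra on the image of
  \<open>e\<close>. These corners form the local system.\<close>

text \<open>The product is a parameter \<open>m\<close> and not the class operation, so that the
  axioms can be instantiated a second time with the opposite product. Regularity is meant in the
  sense of von Neumann.\<close>

locale graded_regular =
  fixes m :: "'r::ab_group_add \<Rightarrow> 'r \<Rightarrow> 'r" (infixl "\<star>" 70)
    and A :: "'g::{ab_group_add, finite} \<Rightarrow> 'r set"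
  assumes assoc: "(x \<star> y) \<star> z = x \<star> (y \<star> z)"
    and add_left: "(x + y) \<star> z = x \<star> z + y \<star> z"
    and add_right: "x \<star> (y + z) = x \<star> y + x \<star> z"
    and regular: "\<exists>y. x \<star> y \<star> x = x"
    and zero_closed: "0 \<in> A g"
    and diff_closed: "x \<in> A g \<Longrightarrow> y \<in> A g \<Longrightarrow> x - y \<in> A g"
    and decomposition: "\<exists>!c. (\<forall>g. c g \<in> A g) \<and> x = (\<Sum>g\<in>UNIV. c g)"
    and mult_closed: "x \<in> A g \<Longrightarrow> y \<in> A h \<Longrightarrow> x \<star> y \<in> A (g + h)"
begin

section \<open>Homogeneous components and products\<close>

lemma add_closed: "x \<in> A g \<Longrightarrow> y \<in> A g \<Longrightarrow> x + y \<in> A g"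
  using diff_closed[of x g "0 - y"] diff_closed[of 0 g y] zero_closed by simp

definition component :: "'r \<Rightarrow> 'g \<Rightarrow> 'r" where
  "component x = (THE c. (\<forall>g. c g \<in> A g) \<and> x = (\<Sum>g\<in>UNIV. c g))"

lemma component_closed: "component x g \<in> A g"
  and sum_component: "(\<Sum>g\<in>UNIV. component x g) = x"
  using theI'[OF decomposition[of x]] unfolding component_def by auto

lemma component_eqI:
  assumes "\<And>g. c g \<in> A g" and "x = (\<Sum>g\<in>UNIV. c g)"
  shows "component x = c"
  unfolding component_def using assms by (intro the1_equality[OF decomposition]) auto

lemma component_add: "component (x + y) g = component x g + component y g"
proof -
  have "component (x + y) = (\<lambda>g. component x g + component y g)"
    by (rule component_eqI) (simp_all add: add_closed component_closed sum.distrib sum_component)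
  then show ?thesis by simp
qed

lemma component_homogeneous:
  assumes "x \<in> A h"
  shows "component x g = (if g = h then x else 0)"
proof -
  have "component x = (\<lambda>g. if g = h then x else 0)"
    by (rule component_eqI) (use assms in \<open>auto simp: zero_closed\<close>)
  then show ?thesis by simp
qed

lemma mult_zero_left: "0 \<star> x = 0"
  using add_left[of 0 0 x] by simp

lemma mult_zero_right: "x \<star> 0 = 0"
  using add_right[of x 0 0] by simp

lemma minus_left: "(- x) \<star> y = - (x \<star> y)"
  using add_left[of x "- x" y] by (simp add: mult_zero_left minus_unique)

lemma minus_right: "x \<star> (- y) = - (x \<star> y)"
  using add_right[of x y "- y"] by (simp add: mult_zero_right minus_unique)

lemma diff_left: "(x - y) \<star> z = x \<star> z - y \<star> z"
  using add_left[of x "- y" z] by (simp add: minus_left)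

lemma diff_right: "x \<star> (y - z) = x \<star> y - x \<star> z"
  using add_right[of x y "- z"] by (simp add: minus_right)

lemma sum_left: "(\<Sum>i\<in>I. f i) \<star> z = (\<Sum>i\<in>I. f i \<star> z)"
  by (induction I rule: infinite_finite_induct) (simp_all add: mult_zero_left add_left)

lemma sum_right: "z \<star> (\<Sum>i\<in>I. f i) = (\<Sum>i\<in>I. z \<star> f i)"
  by (induction I rule: infinite_finite_induct) (simp_all add: mult_zero_right add_right)

lemmas mult_simps = assoc add_left add_right diff_left diff_right mult_zero_left mult_zero_right

lemma sum_closed: "(\<And>i. i \<in> I \<Longrightarrow> f i \<in> A g) \<Longrightarrow> sum f I \<in> A g"
  by (induction I rule: infinite_finite_induct) (simp_all add: zero_closed add_closed)

text \<open>Expanding both factors and sorting the products by total degree \<open>k\<close> writes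
  the product as a sum of homogeneous elements; by uniqueness these are its components.\<close>

lemma component_mult: "component (x \<star> y) k = (\<Sum>g\<in>UNIV. component x g \<star> component y (k - g))"
proof -
  let ?c = "\<lambda>k. \<Sum>g\<in>UNIV. component x g \<star> component y (k - g)"
  have "x \<star> y = (\<Sum>g\<in>UNIV. component x g) \<star> (\<Sum>h\<in>UNIV. component y h)"
    by (simp add: sum_component)
  also have "\<dots> = (\<Sum>g\<in>UNIV. \<Sum>h\<in>UNIV. component x g \<star> component y h)"
    unfolding sum_left sum_right by (rule sum.swap)
  also have "\<dots> = (\<Sum>g\<in>UNIV. \<Sum>k\<in>UNIV. component x g \<star> component y (k - g))"
  proof (rule sum.cong[OF refl])
    show "(\<Sum>h\<in>UNIV. component x g \<star> component y h) =
        (\<Sum>k\<in>UNIV. component x g \<star> component y (k - g))" for g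
      by (rule sum.reindex_bij_witness[of _ "\<lambda>k. k - g" "\<lambda>h. h + g"]) auto
  qed
  also have "\<dots> = (\<Sum>k\<in>UNIV. ?c k)"
    by (rule sum.swap)
  finally have "x \<star> y = (\<Sum>k\<in>UNIV. ?c k)" .
  moreover have "?c k \<in> A k" for k
    using mult_closed[OF component_closed component_closed] by (intro sum_closed) (metis add_diff_cancel_left' diff_add_cancel add.commute)
  ultimately have "component (x \<star> y) = ?c"
    by (intro component_eqI)
  then show ?thesis by simp
qed

text \<open>Only the term \<open>g = 0\<close> of the convolution survives, so left multiplication
  by an element of degree zero commutes with taking components.\<close>

lemma component_mult_left:
  assumes "x \<in> A 0"
  shows "component (x \<star> y) k = x \<star> component y k"
proof -
  have "component (x \<star> y) k = (\<Sum>g::'g\<in>UNIV. if g = 0 then x \<star> component y k else 0)"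
    unfolding component_mult
    by (rule sum.cong) (auto simp: component_homogeneous[OF assms] mult_zero_left)
  then show ?thesis by simp
qed

text \<open>Only \<open>g = k\<close> contributes, since \<open>y\<close> has no component in degree
  \<open>k + h - g\<close> unless that degree is \<open>h\<close>.\<close>

lemma component_mult_right:
  assumes "y \<in> A h"
  shows "component (x \<star> y) (k + h) = component x k \<star> y"
proof -
  have "component (x \<star> y) (k + h) = (\<Sum>g\<in>UNIV. if g = k then component x k \<star> y else 0)"
    unfolding component_mult
    by (rule sum.cong) (auto simp: component_homogeneous[OF assms] mult_zero_right algebra_simps)
  then show ?thesis by simp
qed

section \<open>Idempotent generators and local units of degree zero\<close>

text \<open>Stated for an arbitrary right ideal \<open>J\<close> containing \<open>X\<close>, since \<open>f\<close> lies in the one generated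
  by \<open>X\<close>.\<close>

lemma idempotent_generator:
  assumes "finite X"
  shows "\<exists>f. f \<star> f = f \<and> (\<forall>x\<in>X. f \<star> x = x) \<and>
    (\<forall>J. 0 \<in> J \<longrightarrow> (\<forall>x\<in>J. \<forall>y\<in>J. x + y \<in> J) \<longrightarrow> (\<forall>x\<in>J. \<forall>r. x \<star> r \<in> J) \<longrightarrow> X \<subseteq> J \<longrightarrow> f \<in> J)"
  using assms
proof induction
  case empty
  show ?case by (rule exI[of _ 0]) (simp add: mult_zero_left)
next
  case (insert x X)
  then obtain f where f: "f \<star> f = f" "\<forall>x\<in>X. f \<star> x = x"
    and J: "\<And>J. 0 \<in> J \<Longrightarrow> \<forall>x\<in>J. \<forall>y\<in>J. x + y \<in> J \<Longrightarrow> \<forall>x\<in>J. \<forall>r. x \<star> r \<in> J \<Longrightarrow> X \<subseteq> J \<Longrightarrow> f \<in> J"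
    by blast
  \<comment> \<open>Formally (1 - f) x, the part of \<open>x\<close> that \<open>f\<close> fails to
    fix; left multiplication by \<open>f\<close> kills it.\<close>
  define z where "z = x - f \<star> x"
  obtain y where y: "z \<star> y \<star> z = z"
    using regular by blast
  \<comment> \<open>Formally z y (1 - f). Here z y is an idempotent fixing \<open>z\<close> on the
    left, and the factor 1 - f makes \<open>g\<close> orthogonal to \<open>f\<close> on both sides,
    so \<open>f + g\<close> is an idempotent that also fixes \<open>x\<close>.\<close>
  define g where "g = z \<star> (y - y \<star> f)"
  have ff: "f \<star> (f \<star> u) = f \<star> u" for u
    using f(1) assoc by metis
  have fz: "f \<star> z = 0"
    by (simp add: z_def mult_simps ff)
  have fzu: "f \<star> (z \<star> u) = 0" for u
    using fz assoc mult_zero_left by metis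
  have zyz: "z \<star> (y \<star> z) = z"
    using y assoc by metis
  have zyzu: "z \<star> (y \<star> (z \<star> u)) = z \<star> u" for u
    using zyz assoc by metis
  have fg: "f \<star> g = 0" and gf: "g \<star> f = 0"
    by (simp_all add: g_def mult_simps fz fzu f(1))
  have gg: "g \<star> g = g" and gz: "g \<star> z = z"
    by (simp_all add: g_def mult_simps fz fzu zyz zyzu)
  have gfu: "g \<star> (f \<star> u) = 0" for u
    using gf assoc mult_zero_left by metis
  have gx: "g \<star> x = z"
    using gz by (simp add: z_def mult_simps gfu)
  show ?case
  proof (intro exI[of _ "f + g"] conjI ballI allI impI)
    show "(f + g) \<star> (f + g) = f + g"
      by (simp add: mult_simps f(1) fg gf gg)
    show "(f + g) \<star> u = u" if "u \<in> insert x X" for u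
    proof (cases "u = x")
      case True
      then show ?thesis by (simp add: mult_simps gx) (simp add: z_def)
    next
      case False
      then have "f \<star> u = u"
        using that f(2) by blast
      with gfu[of u] show ?thesis by (simp add: mult_simps)
    qed
    fix K
    assume K: "0 \<in> K" "\<forall>x\<in>K. \<forall>y\<in>K. x + y \<in> K" "\<forall>x\<in>K. \<forall>r. x \<star> r \<in> K" "insert x X \<subseteq> K"
    then have fK: "f \<in> K" by (intro J) auto
    \<comment> \<open>With r = y - y f this reads g = x r + f (- x r). Closure under right
      multiplication puts both terms in \<open>K\<close>, because \<open>x\<close> and
      \<open>f\<close> are there.\<close>
    have "g = x \<star> (y - y \<star> f) + f \<star> (- (x \<star> (y - y \<star> f)))"
      by (simp add: g_def z_def diff_left assoc minus_right)
    also have "\<dots> \<in> K" using K fK by simp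
    finally show "f + g \<in> K" using K fK by blast
  qed
qed

text \<open>If \<open>f\<close> is a left identity of the graded right ideal that it generates, so is its component of
  degree zero.\<close>

lemma left_unit_degree_zero:
  assumes "finite X" and "X \<subseteq> (\<Union>g. A g)"
  obtains e where "e \<in> A 0" and "e \<star> e = e" and "\<And>x. x \<in> X \<Longrightarrow> e \<star> x = x"
proof -
  obtain f where f: "f \<star> f = f" "\<And>x. x \<in> X \<Longrightarrow> f \<star> x = x"
    and gen: "\<And>J. 0 \<in> J \<Longrightarrow> \<forall>x\<in>J. \<forall>y\<in>J. x + y \<in> J \<Longrightarrow> \<forall>x\<in>J. \<forall>r. x \<star> r \<in> J \<Longrightarrow> X \<subseteq> J \<Longrightarrow> f \<in> J"
    using idempotent_generator[OF assms(1)] by blast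
  \<comment> \<open>The elements whose components are all fixed by \<open>f\<close> form a right
    ideal, because each component of x r is a sum of products starting with a component of
    \<open>x\<close>. It contains \<open>X\<close>, whose members are homogeneous, and hence
    contains \<open>f\<close>.\<close>
  define J where "J = {y. \<forall>g. f \<star> component y g = component y g}"
  have "f \<in> J"
  proof (rule gen)
    show "0 \<in> J"
      by (simp add: J_def component_homogeneous[OF zero_closed[of 0]] mult_zero_right)
    show "\<forall>x\<in>J. \<forall>y\<in>J. x + y \<in> J"
      by (simp add: J_def component_add add_right)
    show "\<forall>x\<in>J. \<forall>r. x \<star> r \<in> J"
      by (simp add: J_def component_mult sum_right flip: assoc)
    show "X \<subseteq> J"
      using assms(2) f(2) by (auto simp: J_def component_homogeneous mult_zero_right)
  qed
  define e where "e = component f 0"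
  have e: "e \<in> A 0"
    by (simp add: e_def component_closed)
  have "e \<star> e = component (f \<star> e) (0 + 0)"
    using component_mult_right[OF e, of f 0] by (simp add: e_def)
  also have "f \<star> e = e"
    using \<open>f \<in> J\<close> by (simp add: J_def e_def)
  finally have "e \<star> e = e"
    by (simp add: component_homogeneous[OF e])
  moreover have "e \<star> x = x" if x: "x \<in> X" for x
  proof -
    obtain g where g: "x \<in> A g" using assms(2) x by blast
    have "e \<star> x = component (f \<star> x) (0 + g)"
      using component_mult_right[OF g, of f 0] by (simp add: e_def)
    then show ?thesis
      by (simp add: f(2)[OF x] component_homogeneous[OF g])
  qed
  ultimately show ?thesis using that e by blast
qed

text \<open>The grading group is commutative, so reversing the product respects degrees. Left
  identities for the opposite product are right identities for the original one.\<close>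

lemma opposite: "graded_regular (\<lambda>x y. y \<star> x) A"
proof
  show "\<exists>y. x \<star> (y \<star> x) = x" for x
    using regular[of x] by (simp add: assoc)
  show "y \<star> x \<in> A (g + h)" if "x \<in> A g" "y \<in> A h" for x y g h
    using mult_closed[OF that(2,1)] by (simp add: add.commute)
qed (simp_all add: assoc add_left add_right zero_closed diff_closed decomposition)

text \<open>From \<open>e\<^sub>1\<close> acting as a left identity on \<open>X\<close> and on a right identity \<open>e\<^sub>2\<close> of \<open>X\<close>, one gets the
  two-sided identity \<open>e\<^sub>1 + e\<^sub>2 - e\<^sub>2 e\<^sub>1\<close>.\<close>

lemma local_unit_degree_zero:
  assumes "finite X" and "X \<subseteq> (\<Union>g. A g)"
  obtains e where "e \<in> A 0" and "e \<star> e = e" and "\<And>x. x \<in> X \<Longrightarrow> e \<star> x = x \<and> x \<star> e = x"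
proof -
  interpret op: graded_regular "\<lambda>x y. y \<star> x" A by (rule opposite)
  obtain e2 where e2: "e2 \<in> A 0" "e2 \<star> e2 = e2" "\<And>x. x \<in> X \<Longrightarrow> x \<star> e2 = x"
    using op.left_unit_degree_zero[OF assms] by blast
  \<comment> \<open>Including \<open>e2\<close> among the elements fixed by \<open>e1\<close> gives
    e1 e2 = e2, the relation behind the idempotence of \<open>e\<close>.\<close>
  obtain e1 where e1: "e1 \<in> A 0" "e1 \<star> e1 = e1" "\<And>x. x \<in> insert e2 X \<Longrightarrow> e1 \<star> x = x"
    using left_unit_degree_zero[of "insert e2 X"] assms e2(1) by blast
  have e12: "e1 \<star> e2 = e2" using e1(3) by simp
  then have e12u: "e1 \<star> (e2 \<star> u) = e2 \<star> u" for u
    using assoc by metis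
  have idem: "e1 \<star> (e1 \<star> u) = e1 \<star> u" "e2 \<star> (e2 \<star> u) = e2 \<star> u" for u
    using e1(2) e2(2) assoc by metis+
  \<comment> \<open>Formally 1 - (1 - e2)(1 - e1).\<close>
  define e where "e = e1 + e2 - e2 \<star> e1"
  have e21: "e2 \<star> e1 \<in> A 0"
    using mult_closed[OF e2(1) e1(1)] by simp
  then have "e \<in> A 0"
    using e1(1) e2(1) by (simp add: e_def add_closed diff_closed)
  moreover have "e \<star> e = e"
    by (simp add: e_def mult_simps e12 e12u idem e1(2) e2(2))
  moreover have "e \<star> x = x \<and> x \<star> e = x" if "x \<in> X" for x
  proof -
    have x: "e1 \<star> x = x" "x \<star> e2 = x" using that e1(3) e2(3) by auto
    then have "x \<star> (e2 \<star> u) = x \<star> u" for u using assoc by metis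
    with x show ?thesis by (simp add: e_def mult_simps)
  qed
  ultimately show ?thesis using that by blast
qed

end

section \<open>The tensor product as finite-rank operators\<close>

lemma lookup_free_scale [simp]:
  "Poly_Mapping.lookup (free_scale c x) k = c * Poly_Mapping.lookup x k"
  by (simp add: free_scale_def Poly_Mapping.map.rep_eq when_def)

interpretation free: vector_space "free_scale :: 'f::field \<Rightarrow> ('f, 'v) free_sp \<Rightarrow> _"
  by unfold_locales (auto intro!: poly_mapping_eqI simp: lookup_add algebra_simps)

interpretation dual: vector_space "dual_scale :: 'f::field \<Rightarrow> ('v \<Rightarrow> 'f) \<Rightarrow> _"
  by unfold_locales (auto simp: dual_scale_def fun_eq_iff algebra_simps)

lemma free_expansion:
  "(\<Sum>k\<in>Poly_Mapping.keys x. free_scale (Poly_Mapping.lookup x k) (Poly_Mapping.single k 1)) = x"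
proof (rule poly_mapping_eqI)
  fix k
  have "(\<Sum>j\<in>Poly_Mapping.keys x. Poly_Mapping.lookup x j * (1 when j = k)) =
      (\<Sum>j\<in>Poly_Mapping.keys x. if j = k then Poly_Mapping.lookup x k else 0)"
    by (intro sum.cong) (auto simp: when_def)
  then show "Poly_Mapping.lookup
      (\<Sum>k\<in>Poly_Mapping.keys x. free_scale (Poly_Mapping.lookup x k) (Poly_Mapping.single k 1)) k =
      Poly_Mapping.lookup x k"
    by (simp add: lookup_sum lookup_single sum.delta not_in_keys_iff_lookup_eq_zero del: single_one)
qed

lemma subspace_free_space: "free.subspace (free_space P)"
proof (rule free.subspaceI)
  show "x + y \<in> free_space P" if "x \<in> free_space P" "y \<in> free_space P" for x y
    using that keys_add[of x y] by (auto simp: free_space_def)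
  show "free_scale c x \<in> free_space P" if "x \<in> free_space P" for c x
    using that by (auto simp: free_space_def in_keys_iff)
qed (simp add: free_space_def)

lemma free_gen_closed: "p \<in> P \<Longrightarrow> free_gen v p \<in> free_space P"
  by (simp add: free_space_def)

section \<open>Functionals of a dual pair and dual bases\<close>

locale dual_pair =
  fixes scale :: "'f::field \<Rightarrow> 'v::ab_group_add \<Rightarrow> 'v" and P :: "('v \<Rightarrow> 'f) set"
  assumes mutually_dual: "mutually_dual_spaces scale P"

sublocale dual_pair \<subseteq> vector_space scale
  using mutually_dual by (simp add: mutually_dual_spaces_def)

context dual_pair
begin

lemma subspace_dual: "dual.subspace P"
  and nondegenerate: "(\<And>p. p \<in> P \<Longrightarrow> p v = 0) \<Longrightarrow> v = 0"
  using mutually_dual by (auto simp: mutually_dual_spaces_def)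

lemma functional_linear: "p \<in> P \<Longrightarrow> Vector_Spaces.linear scale (*) p"
  using mutually_dual by (auto simp: mutually_dual_spaces_def dual_space_def)

lemma functional_add: "p \<in> P \<Longrightarrow> p (v + w) = p v + p w"
  and functional_scale: "p \<in> P \<Longrightarrow> p (scale c v) = c * p v"
  and functional_diff: "p \<in> P \<Longrightarrow> p (v - w) = p v - p w"
  and functional_sum: "p \<in> P \<Longrightarrow> p (\<Sum>i\<in>I. f i) = (\<Sum>i\<in>I. p (f i))"
proof -
  assume "p \<in> P"
  then interpret p: Vector_Spaces.linear scale "(*)" p by (rule functional_linear)
  show "p (v + w) = p v + p w" "p (scale c v) = c * p v" "p (v - w) = p v - p w"
    "p (\<Sum>i\<in>I. f i) = (\<Sum>i\<in>I. p (f i))"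
    by (simp_all add: p.add p.scale p.diff p.sum)
qed

text \<open>Nondegeneracy settles the empty set. For a new vector \<open>b\<close> outside the span
  of \<open>B\<close>, a functional \<open>r\<close> that kills \<open>B\<close> but not
  \<open>b\<close> is used to correct another functional so that it vanishes at \<open>b\<close> as
  well.\<close>

lemma separating_functional:
  assumes "finite B" and "v \<notin> span B"
  shows "\<exists>q\<in>P. (\<forall>b\<in>B. q b = 0) \<and> q v \<noteq> 0"
  using assms
proof (induction arbitrary: v)
  case empty
  then show ?case using nondegenerate[of v] by auto
next
  case (insert b B)
  show ?case
  proof (cases "b \<in> span B")
    case True
    then have "v \<notin> span B" using insert.prems by (simp add: span_redundant)
    then obtain q where q: "q \<in> P" "\<forall>b\<in>B. q b = 0" "q v \<noteq> 0" using insert.IH by blast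
    interpret q: Vector_Spaces.linear scale "(*)" q using q(1) by (rule functional_linear)
    have "q b = 0" using q.eq_0_on_span[OF _ True] q(2) by blast
    with q show ?thesis by blast
  next
    case False
    then obtain r where r: "r \<in> P" "\<forall>b\<in>B. r b = 0" "r b \<noteq> 0" using insert.IH by blast
    \<comment> \<open>Subtracts the multiple of \<open>b\<close> for which r v' = 0. The result is
      still outside the span of \<open>B\<close>, since otherwise \<open>v\<close> would lie in the
      span of \<open>insert b B\<close>.\<close>
    define v' where "v' = v - scale (r v / r b) b"
    have "v' \<notin> span B"
      using insert.prems span_breakdown_eq[of v b B] unfolding v'_def by blast
    then obtain q where q: "q \<in> P" "\<forall>b\<in>B. q b = 0" "q v' \<noteq> 0" using insert.IH by blast
    \<comment> \<open>Chosen to vanish at \<open>b\<close>. The two corrections match: q' v equals q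
      v', which is nonzero.\<close>
    define q' where "q' = q - dual_scale (q b / r b) r"
    have "q' \<in> P"
      unfolding q'_def
      by (intro dual.subspace_diff[OF subspace_dual] dual.subspace_scale[OF subspace_dual] q r)
    moreover have "q' v = q v'"
      using q(1) by (simp add: q'_def v'_def dual_scale_def functional_diff functional_scale)
    ultimately show ?thesis
      using q r by (intro bexI[of _ q']) (auto simp: q'_def dual_scale_def)
  qed
qed

text \<open>Separating each \<open>b\<close> from the other basis vectors and normalising yields
  coordinate functionals inside \<open>P\<close>, even when \<open>P\<close> is far smaller than the
  full dual.\<close>

lemma dual_basis:
  assumes "finite B" and "independent B"
  obtains q where "\<And>b. b \<in> B \<Longrightarrow> q b \<in> P" and "\<And>b c. b \<in> B \<Longrightarrow> c \<in> B \<Longrightarrow> q b c = (if b = c then 1 else 0)"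
    and "\<And>v. v \<in> span B \<Longrightarrow> (\<Sum>b\<in>B. scale (q b v) b) = v"
proof -
  have "\<exists>q\<in>P. q b = 1 \<and> (\<forall>c\<in>B - {b}. q c = 0)" if "b \<in> B" for b
  proof -
    have "b \<notin> span (B - {b})" using assms(2) that dependent_def by blast
    then obtain q where q: "q \<in> P" "\<forall>c\<in>B - {b}. q c = 0" "q b \<noteq> 0"
      using separating_functional[of "B - {b}" b] assms(1) by blast
    then show ?thesis
      by (intro bexI[of _ "dual_scale (1 / q b) q"] dual.subspace_scale[OF subspace_dual])
        (auto simp: dual_scale_def)
  qed
  then obtain q where q: "\<And>b. b \<in> B \<Longrightarrow> q b \<in> P \<and> q b b = 1 \<and> (\<forall>c\<in>B - {b}. q b c = 0)"
    by metis
  have *: "q b c = (if b = c then 1 else 0)" if "b \<in> B" "c \<in> B" for b c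
    using q that by auto
  show ?thesis
  proof (rule that)
    fix v assume "v \<in> span B"
    then obtain u where v: "v = (\<Sum>c\<in>B. scale (u c) c)"
      using span_finite[OF assms(1)] by auto
    have "q b v = u b" if "b \<in> B" for b
    proof -
      have "q b v = (\<Sum>c\<in>B. if b = c then u b else 0)"
        unfolding v using q[OF that] * that
        by (subst functional_sum) (auto simp: functional_scale intro!: sum.cong)
      then show ?thesis using assms(1) that by simp
    qed
    then show "(\<Sum>b\<in>B. scale (q b v) b) = v" by (simp add: v)
  qed (use q * in auto)
qed

section \<open>The action of the free space on vectors\<close>

text \<open>A generator (v, p) acts as the operator w \<mapsto> p(w) v, of rank at most one. The
  action is defined on representatives; its invariance on cosets follows from
  \<open>null_closed\<close>.\<close>

definition act :: "('f, 'v) free_sp \<Rightarrow> 'v \<Rightarrow> 'v" where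
  "act x w = (\<Sum>(v, p)\<in>Poly_Mapping.keys x. scale (Poly_Mapping.lookup x (v, p) * p w) v)"

text \<open>Allows the sums for elements with different supports to be taken over one common index
  set.\<close>

lemma act_superset:
  assumes "finite S" and "Poly_Mapping.keys x \<subseteq> S"
  shows "act x w = (\<Sum>(v, p)\<in>S. scale (Poly_Mapping.lookup x (v, p) * p w) v)"
  unfolding act_def using assms by (intro sum.mono_neutral_left) (auto simp: in_keys_iff)

lemma act_add: "act (x + y) w = act x w + act y w"
proof -
  let ?S = "Poly_Mapping.keys x \<union> Poly_Mapping.keys y"
  have "act (x + y) w = (\<Sum>(v, p)\<in>?S. scale (Poly_Mapping.lookup (x + y) (v, p) * p w) v)"
    by (rule act_superset) (simp_all add: keys_add)
  then show ?thesis
    by (simp add: act_superset[of ?S x] act_superset[of ?S y] lookup_add algebra_simps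
        case_prod_unfold sum.distrib)
qed

lemma act_scale: "act (free_scale c x) w = scale c (act x w)"
proof -
  have "act (free_scale c x) w =
      (\<Sum>(v, p)\<in>Poly_Mapping.keys x. scale (Poly_Mapping.lookup (free_scale c x) (v, p) * p w) v)"
    by (rule act_superset) (auto simp: in_keys_iff)
  then show ?thesis
    by (simp add: act_def scale_sum_right case_prod_unfold mult.assoc)
qed

lemma act_diff: "act (x - y) w = act x w - act y w"
  using act_add[of "x - y" y w] by simp

lemma act_zero [simp]: "act 0 w = 0"
  by (simp add: act_def)

lemma act_sum: "act (\<Sum>i\<in>I. f i) w = (\<Sum>i\<in>I. act (f i) w)"
  by (induction I rule: infinite_finite_induct) (simp_all add: act_add)

lemma act_gen [simp]: "act (free_gen v p) w = scale (p w) v"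
  by (simp add: act_def)

section \<open>The bilinearity relations as the kernel of the action\<close>

definition null :: "('f, 'v) free_sp set" where
  "null = free.span (bilin_relations scale P)"

text \<open>Each generating relation is an instance of bilinearity, which the operators w \<mapsto>
  p(w) v satisfy, and it involves only functionals from the subspace \<open>P\<close>. Both
  properties define subspaces and so extend to the span.\<close>

lemma null_closed: "x \<in> null \<Longrightarrow> x \<in> free_space P \<and> (\<forall>w. act x w = 0)"
proof -
  note closed = free.subspace_diff[OF subspace_free_space] free.subspace_scale[OF subspace_free_space]
    free_gen_closed dual.subspace_add[OF subspace_dual] dual.subspace_scale[OF subspace_dual]
  have "x \<in> free_space P \<and> (\<forall>w. act x w = 0)" if "x \<in> bilin_relations scale P" for x
    using that unfolding bilin_relations_def
  proof (elim UnE CollectE exE conjE)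
    fix v w p assume "x = free_gen (v + w) p - free_gen v p - free_gen w p" "p \<in> P"
    then show ?thesis by (auto simp: act_diff scale_right_distrib intro!: closed simp del: diff_diff_eq)
  next
    fix v p q assume "x = free_gen v (p + q) - free_gen v p - free_gen v q" "p \<in> P" "q \<in> P"
    then show ?thesis by (auto simp: act_diff scale_left_distrib intro!: closed simp del: diff_diff_eq)
  next
    fix c v p assume "x = free_gen (scale c v) p - free_scale c (free_gen v p)" "p \<in> P"
    then show ?thesis by (auto simp: act_diff act_scale mult.commute intro!: closed)
  next
    fix c v p assume "x = free_gen v (dual_scale c p) - free_scale c (free_gen v p)" "p \<in> P"
    then show ?thesis
      by (auto simp: act_diff act_scale intro!: closed) (simp add: dual_scale_def)
  qed
  then have "bilin_relations scale P \<subseteq> {x \<in> free_space P. \<forall>w. act x w = 0}"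
    by blast
  moreover have "free.subspace {x \<in> free_space P. \<forall>w. act x w = 0}"
    by (rule free.subspaceI)
      (auto simp: act_add act_scale intro: free.subspace_0[OF subspace_free_space]
        free.subspace_add[OF subspace_free_space] free.subspace_scale[OF subspace_free_space])
  ultimately have "null \<subseteq> {x \<in> free_space P. \<forall>w. act x w = 0}"
    unfolding null_def by (rule free.span_minimal)
  then show "x \<in> null \<Longrightarrow> x \<in> free_space P \<and> (\<forall>w. act x w = 0)" by blast
qed

lemma null_trans: "x - y \<in> null \<Longrightarrow> y - z \<in> null \<Longrightarrow> x - z \<in> null"
  unfolding null_def using free.span_add[of "x - y" _ "y - z"] by simp

lemma null_sum:
  "(\<And>i. i \<in> I \<Longrightarrow> f i - g i \<in> null) \<Longrightarrow> (\<Sum>i\<in>I. f i) - (\<Sum>i\<in>I. g i) \<in> null"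
  unfolding null_def by (simp add: free.span_sum flip: sum_subtractf)

lemma null_gen_add_left: "p \<in> P \<Longrightarrow> free_gen (v + w) p - free_gen v p - free_gen w p \<in> null"
  and null_gen_add_right:
    "p \<in> P \<Longrightarrow> q \<in> P \<Longrightarrow> free_gen v (p + q) - free_gen v p - free_gen v q \<in> null"
  and null_gen_scale_left: "p \<in> P \<Longrightarrow> free_gen (scale c v) p - free_scale c (free_gen v p) \<in> null"
  and null_gen_scale_right:
    "p \<in> P \<Longrightarrow> free_gen v (dual_scale c p) - free_scale c (free_gen v p) \<in> null"
  unfolding null_def bilin_relations_def by (rule free.span_base, blast)+

lemma null_gen_zero_left: "p \<in> P \<Longrightarrow> free_gen 0 p \<in> null"
  using null_gen_scale_left[of p 0 0] by simp

lemma null_gen_zero_right: "free_gen v 0 \<in> null"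
  using null_gen_scale_right[of 0 v 0] dual.subspace_0[OF subspace_dual]
  by simp

lemma null_add_trans: "x - y - z \<in> null \<Longrightarrow> z - u \<in> null \<Longrightarrow> x - (y + u) \<in> null"
  using null_trans[of "x - y" z u] by (simp add: diff_diff_eq)

lemma null_gen_sum_left:
  assumes "p \<in> P"
  shows "free_gen (\<Sum>i\<in>I. f i) p - (\<Sum>i\<in>I. free_gen (f i) p) \<in> null"
proof (induction I rule: infinite_finite_induct)
  case (insert i I)
  show ?case
    unfolding sum.insert[OF insert.hyps]
    by (rule null_add_trans[OF null_gen_add_left[OF assms] insert.IH])
qed (simp_all add: null_gen_zero_left assms)

lemma null_gen_sum_right:
  assumes "\<And>i. i \<in> I \<Longrightarrow> q i \<in> P"
  shows "free_gen v (\<Sum>i\<in>I. q i) - (\<Sum>i\<in>I. free_gen v (q i)) \<in> null"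
  using assms
proof (induction I rule: infinite_finite_induct)
  case (insert i I)
  have "free_gen v (q i + sum q I) - free_gen v (q i) - free_gen v (sum q I) \<in> null"
    using insert.prems by (intro null_gen_add_right dual.subspace_sum[OF subspace_dual]) auto
  moreover have "free_gen v (sum q I) - (\<Sum>i\<in>I. free_gen v (q i)) \<in> null"
    using insert by blast
  ultimately show ?case
    unfolding sum.insert[OF insert.hyps] by (rule null_add_trans)
qed (simp_all add: null_gen_zero_right)

text \<open>Modulo the relations, \<open>x\<close> is a combination of elements \<open>(b, Q b)\<close> with \<open>b\<close> in a basis; if \<open>x\<close>
  acts as zero then every functional \<open>Q b\<close> vanishes.\<close>

lemma act_zero_imp_null:
  assumes x: "x \<in> free_space P" and x0: "\<And>w. act x w = 0"
  shows "x \<in> null"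
proof -
  let ?K = "Poly_Mapping.keys x"
  obtain B where B: "B \<subseteq> fst ` ?K" "independent B" "fst ` ?K \<subseteq> span B"
    by (rule maximal_independent_subset)
  have fin: "finite B" using B(1) by (rule finite_subset) simp
  \<comment> \<open>The coefficient of \<open>b\<close> when the term of \<open>x\<close> at
    \<open>k\<close> is expanded in the basis \<open>B\<close>. Once it is moved into the second
    factor, \<open>Q b\<close> collects all functionals paired with \<open>b\<close>.\<close>
  define r where "r k b = Poly_Mapping.lookup x k * representation B (fst k) b"
    for k :: "'v \<times> ('v \<Rightarrow> 'f)" and b
  define Q where "Q b = (\<Sum>k\<in>?K. dual_scale (r k b) (snd k))" for b
  have KP: "snd k \<in> P" if "k \<in> ?K" for k
    using x that by (auto simp: free_space_def)
  have QP: "dual_scale (r k b) (snd k) \<in> P" if "k \<in> ?K" for k b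
    using KP[OF that] by (rule dual.subspace_scale[OF subspace_dual])
  have step: "free_scale (Poly_Mapping.lookup x k) (free_gen (fst k) (snd k)) -
      (\<Sum>b\<in>B. free_gen b (dual_scale (r k b) (snd k))) \<in> null" if k: "k \<in> ?K" for k
  proof -
    have p: "snd k \<in> P" using KP[OF k] .
    have "fst k \<in> span B" using B(3) k by blast
    then have "scale (Poly_Mapping.lookup x k) (\<Sum>b\<in>B. scale (representation B (fst k) b) b) =
        scale (Poly_Mapping.lookup x k) (fst k)"
      using sum_representation_eq[OF B(2) _ fin order_refl] by simp
    then have exp: "scale (Poly_Mapping.lookup x k) (fst k) = (\<Sum>b\<in>B. scale (r k b) b)"
      by (simp add: r_def scale_sum_right)
    have "- (free_gen (scale (Poly_Mapping.lookup x k) (fst k)) (snd k) -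
      free_scale (Poly_Mapping.lookup x k) (free_gen (fst k) (snd k))) \<in> null"
      using null_gen_scale_left[OF p] unfolding null_def by (rule free.span_neg)
    then have 1: "free_scale (Poly_Mapping.lookup x k) (free_gen (fst k) (snd k)) -
      free_gen (\<Sum>b\<in>B. scale (r k b) b) (snd k) \<in> null"
      by (simp add: exp)
    have "free_gen (scale (r k b) b) (snd k) - free_gen b (dual_scale (r k b) (snd k)) \<in> null" for b
      using free.span_diff[OF null_gen_scale_left[OF p, of "r k b" b, unfolded null_def]
          null_gen_scale_right[OF p, of b "r k b", unfolded null_def]] by (simp add: null_def)
    then have "(\<Sum>b\<in>B. free_gen (scale (r k b) b) (snd k)) -
        (\<Sum>b\<in>B. free_gen b (dual_scale (r k b) (snd k))) \<in> null"
      by (intro null_sum)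
    then show ?thesis
      using null_trans[OF 1 null_trans[OF null_gen_sum_left[OF p]]] by blast
  qed
  have "x - (\<Sum>b\<in>B. \<Sum>k\<in>?K. free_gen b (dual_scale (r k b) (snd k))) \<in> null"
  proof -
    have "(\<Sum>k\<in>?K. free_scale (Poly_Mapping.lookup x k) (free_gen (fst k) (snd k))) -
        (\<Sum>k\<in>?K. \<Sum>b\<in>B. free_gen b (dual_scale (r k b) (snd k))) \<in> null"
      by (rule null_sum) (rule step)
    then show ?thesis by (simp add: free_expansion sum.swap[of _ B ?K])
  qed
  moreover have "(\<Sum>b\<in>B. \<Sum>k\<in>?K. free_gen b (dual_scale (r k b) (snd k))) -
      (\<Sum>b\<in>B. free_gen b (Q b)) \<in> null"
  proof (rule null_sum)
    fix b
    have "- (free_gen b (Q b) - (\<Sum>k\<in>?K. free_gen b (dual_scale (r k b) (snd k)))) \<in> null"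
      using null_gen_sum_right[of ?K "\<lambda>k. dual_scale (r k b) (snd k)" b] QP
      unfolding null_def Q_def by (intro free.span_neg) blast
    then show "(\<Sum>k\<in>?K. free_gen b (dual_scale (r k b) (snd k))) - free_gen b (Q b) \<in> null"
      by simp
  qed
  ultimately have xQ: "x - (\<Sum>b\<in>B. free_gen b (Q b)) \<in> null"
    by (rule null_trans)
  \<comment> \<open>At each \<open>w\<close> the vanishing action is a linear relation among the
    members of \<open>B\<close> with coefficients \<open>Q b w\<close>, so independence makes every
    coefficient zero.\<close>
  have "Q b = 0" if "b \<in> B" for b
  proof
    fix w
    have "(\<Sum>b\<in>B. scale (Q b w) b) = 0"
      using null_closed[OF xQ] x0 by (simp add: act_diff act_sum)
    then show "Q b w = 0 w"
      using independentD[OF B(2) fin order_refl _ that, of "\<lambda>b. Q b w"] by simp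
  qed
  then have "(\<Sum>b\<in>B. free_gen b (Q b)) \<in> null"
    using null_gen_zero_right unfolding null_def by (intro free.span_sum) simp
  then show ?thesis
    using free.span_add[OF xQ[unfolded null_def], of "\<Sum>b\<in>B. free_gen b (Q b)"]
    by (simp add: null_def)
qed

text \<open>Inside \<open>free_space P\<close> the relations span exactly the kernel of the action.
  That \<open>y\<close> lies in \<open>free_space P\<close> is part of the equivalence because
  cosets are formed among all finitely supported functions on pairs, with arbitrary second
  entries.\<close>

lemma null_iff_act_eq:
  assumes "x \<in> free_space P"
  shows "y - x \<in> null \<longleftrightarrow> y \<in> free_space P \<and> act y = act x"
proof
  assume "y - x \<in> null"
  then have *: "y - x \<in> free_space P" "\<And>w. act (y - x) w = 0"
    using null_closed by blast+
  have "y \<in> free_space P"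
    using free.subspace_add[OF subspace_free_space *(1) assms] by simp
  moreover have "act y = act x"
    using *(2) by (intro ext) (simp add: act_diff)
  ultimately show "y \<in> free_space P \<and> act y = act x" by blast
next
  assume y: "y \<in> free_space P \<and> act y = act x"
  show "y - x \<in> null"
  proof (rule act_zero_imp_null)
    show "y - x \<in> free_space P"
      using y assms by (intro free.subspace_diff[OF subspace_free_space]) blast+
    show "act (y - x) w = 0" for w
      using y by (simp add: act_diff)
  qed
qed

section \<open>Tensor operations as operations on operators\<close>

lemma tensor_class_eq:
  assumes "x \<in> free_space P"
  shows "tensor_class scale P x = {y \<in> free_space P. act y = act x}"
  unfolding tensor_class_def using null_iff_act_eq[OF assms] by (simp add: null_def)

lemma tensor_class_eq_iff:
  assumes "x \<in> free_space P" and "y \<in> free_space P"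
  shows "tensor_class scale P x = tensor_class scale P y \<longleftrightarrow> act x = act y"
  using assms by (auto simp: tensor_class_eq)

lemma free_mult_closed: "y \<in> free_space P \<Longrightarrow> free_mult x y \<in> free_space P"
  unfolding free_mult_def case_prod_unfold
  by (intro free.subspace_sum[OF subspace_free_space] free.subspace_scale[OF subspace_free_space]
      free_gen_closed) (auto simp: free_space_def)

text \<open>On generators both sides send u to p(w) q(u) v: the product of tensors is composition of
  operators. Linearity of the functionals occurring in \<open>x\<close> carries them through the sum
  that defines \<open>act y u\<close>.\<close>

lemma act_mult:
  assumes "x \<in> free_space P"
  shows "act (free_mult x y) u = act x (act y u)"
proof -
  have "act x (act y u) = (\<Sum>j\<in>Poly_Mapping.keys x. \<Sum>k\<in>Poly_Mapping.keys y.
      scale (Poly_Mapping.lookup x j * (Poly_Mapping.lookup y k * snd k u * snd j (fst k))) (fst j))"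
    unfolding act_def[of x]
  proof (simp add: case_prod_unfold, rule sum.cong[OF refl])
    fix j assume "j \<in> Poly_Mapping.keys x"
    then have "snd j \<in> P" using assms by (auto simp: free_space_def)
    then show "scale (Poly_Mapping.lookup x j * snd j (act y u)) (fst j) = (\<Sum>k\<in>Poly_Mapping.keys y.
        scale (Poly_Mapping.lookup x j * (Poly_Mapping.lookup y k * snd k u * snd j (fst k))) (fst j))"
      by (simp add: act_def case_prod_unfold functional_sum functional_scale sum_distrib_left
          scale_sum_left)
  qed
  then show ?thesis
    by (simp add: free_mult_def act_sum act_scale case_prod_unfold mult_ac)
qed

text \<open>A coset consists of all representatives with a given action, so the cosets in each
  defining union coincide. The unions are nonempty because \<open>x\<close> and \<open>y\<close>
  belong to their own cosets.\<close>

lemma tensor_alg_ops: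
  assumes "x \<in> free_space P" and "y \<in> free_space P"
  shows "alg_add (tensor_alg scale P) (tensor_class scale P x) (tensor_class scale P y) =
      tensor_class scale P (x + y)"
    and "alg_mult (tensor_alg scale P) (tensor_class scale P x) (tensor_class scale P y) =
      tensor_class scale P (free_mult x y)"
    and "alg_scale (tensor_alg scale P) c (tensor_class scale P x) =
      tensor_class scale P (free_scale c x)"
proof -
  let ?C = "tensor_class scale P"
  have self: "x \<in> ?C x" "y \<in> ?C y" using assms by (simp_all add: tensor_class_eq)
  have "?C (a + b) = ?C (x + y) \<and> ?C (free_mult a b) = ?C (free_mult x y) \<and>
      ?C (free_scale c a) = ?C (free_scale c x)"
    if "a \<in> ?C x" "b \<in> ?C y" for a b
  proof -
    have ab: "a \<in> free_space P" "b \<in> free_space P" "act a = act x" "act b = act y"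
      using that assms by (simp_all add: tensor_class_eq)
    have "act (a + b) = act (x + y)" "act (free_mult a b) = act (free_mult x y)"
      "act (free_scale c a) = act (free_scale c x)"
      using ab assms by (auto simp: act_add act_mult act_scale)
    then show ?thesis
      using ab assms by (simp add: tensor_class_eq_iff free.subspace_add[OF subspace_free_space]
          free.subspace_scale[OF subspace_free_space] free_mult_closed)
  qed
  then show "alg_add (tensor_alg scale P) (?C x) (?C y) = ?C (x + y)"
    "alg_mult (tensor_alg scale P) (?C x) (?C y) = ?C (free_mult x y)"
    "alg_scale (tensor_alg scale P) c (?C x) = ?C (free_scale c x)"
    unfolding tensor_alg_def algebra_struct.simps using self by blast+
qed

lemma linear_act:
  assumes "x \<in> free_space P"
  shows "Vector_Spaces.linear scale scale (act x)"
proof -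
  have "snd k \<in> P" if "k \<in> Poly_Mapping.keys x" for k
    using assms that by (auto simp: free_space_def)
  then show ?thesis
    by (unfold_locales; unfold act_def case_prod_unfold)
      (simp_all add: functional_add functional_scale algebra_simps sum.distrib scale_sum_right)
qed

lemma act_in_span: "act x w \<in> span (fst ` Poly_Mapping.keys x)"
  unfolding act_def case_prod_unfold by (intro span_sum span_scale span_base) simp

end

section \<open>Corners\<close>

text \<open>For idempotent \<open>e\<close> this is e R e; the two fixed-point equations make
  inclusions between corners easy to check.\<close>

definition corner :: "'r::ring \<Rightarrow> 'r set" where
  "corner e = {x. e * x = x \<and> x * e = x}"

section \<open>Regularity and matrix corners of the operator algebra\<close>

text \<open>Replaces the cosets of the tensor algebra by operators: \<open>\<rho>\<close> is
  faithful, and its image consists of exactly the operators given by elements of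
  \<open>free_space P\<close>.\<close>

locale finite_rank_representation = dual_pair scale P + R: assoc_algebra scale_R
  for scale :: "'f::field \<Rightarrow> 'v::ab_group_add \<Rightarrow> 'v" and P
    and scale_R :: "'f \<Rightarrow> 'r::ring \<Rightarrow> 'r" +
  fixes \<rho> :: "'r \<Rightarrow> 'v \<Rightarrow> 'v"
  assumes rep_add: "\<rho> (x + y) v = \<rho> x v + \<rho> y v"
    and rep_mult: "\<rho> (x * y) v = \<rho> x (\<rho> y v)"
    and rep_scale: "\<rho> (scale_R c x) v = scale c (\<rho> x v)"
    and rep_inj: "inj \<rho>"
    and range_rep: "range \<rho> = act ` free_space P"
begin

lemma rep_eqI: "(\<And>v. \<rho> x v = \<rho> y v) \<Longrightarrow> x = y"
  by (rule injD[OF rep_inj]) (rule ext)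

lemma rep_linear: "Vector_Spaces.linear scale scale (\<rho> x)"
  and rep_range_finite: "\<exists>K. finite K \<and> range (\<rho> x) \<subseteq> span K"
proof -
  obtain y where y: "y \<in> free_space P" "\<rho> x = act y" using range_rep by blast
  show "Vector_Spaces.linear scale scale (\<rho> x)"
    unfolding y(2) by (rule linear_act[OF y(1)])
  show "\<exists>K. finite K \<and> range (\<rho> x) \<subseteq> span K"
    unfolding y(2) by (intro exI[of _ "fst ` Poly_Mapping.keys y"]) (auto simp: act_in_span)
qed

lemma rep_range_basis:
  fixes x :: 'r
  obtains B where "finite B" "independent B" "span B = range (\<rho> x)"
proof -
  interpret T: Vector_Spaces.linear scale scale "\<rho> x" by (rule rep_linear)
  obtain B where B: "B \<subseteq> range (\<rho> x)" "independent B" "range (\<rho> x) \<subseteq> span B"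
    by (rule maximal_independent_subset)
  obtain K where "finite K" "range (\<rho> x) \<subseteq> span K"
    using rep_range_finite by blast
  then have "finite B"
    using independent_span_bound[of K B] B(1,2) by blast
  moreover have "subspace (range (\<rho> x))"
    by (rule T.subspace_image) simp
  then have "span B = range (\<rho> x)"
    using B by (intro span_subspace)
  ultimately show ?thesis using that B(2) by blast
qed

text \<open>The sum is the action of the corresponding combination of generators, so it lies in the
  image of \<open>\<rho>\<close>. This is how elements with a prescribed action are
  produced.\<close>

lemma rep_surj:
  assumes "\<And>i. i \<in> I \<Longrightarrow> q i \<in> P"
  obtains x where "\<And>w. \<rho> x w = (\<Sum>i\<in>I. scale (q i w) (v i))"
proof -
  have "(\<Sum>i\<in>I. free_gen (v i) (q i)) \<in> free_space P"
    using assms by (intro free.subspace_sum[OF subspace_free_space] free_gen_closed)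
  then have "act (\<Sum>i\<in>I. free_gen (v i) (q i)) \<in> range \<rho>"
    unfolding range_rep by (rule imageI)
  then obtain x where "act (\<Sum>i\<in>I. free_gen (v i) (q i)) = \<rho> x"
    by (rule rangeE)
  then have "\<rho> x w = act (\<Sum>i\<in>I. free_gen (v i) (q i)) w" for w
    by simp
  then show ?thesis by (intro that) (simp add: act_sum)
qed

text \<open>Let \<open>y\<close> send each vector of a basis of the image of \<open>x\<close> to a
  preimage under \<open>x\<close>, extended to all of V by dual functionals from \<open>P\<close>.
  Then x y acts as the identity on the image of \<open>x\<close>.\<close>

lemma regular: "\<exists>y. (x :: 'r) * y * x = x"
proof -
  interpret T: Vector_Spaces.linear scale scale "\<rho> x" by (rule rep_linear)
  obtain B where B: "finite B" "independent B" "span B = range (\<rho> x)"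
    by (rule rep_range_basis)
  obtain q where q: "\<And>b. b \<in> B \<Longrightarrow> q b \<in> P"
    "\<And>b c. b \<in> B \<Longrightarrow> c \<in> B \<Longrightarrow> q b c = (if b = c then 1 else 0)"
    "\<And>v. v \<in> span B \<Longrightarrow> (\<Sum>b\<in>B. scale (q b v) b) = v"
    using dual_basis[OF B(1,2)] by blast
  have "\<exists>w. \<rho> x w = b" if "b \<in> B" for b
    using B(3) span_base[OF that] by auto
  then obtain w where w: "\<And>b. b \<in> B \<Longrightarrow> \<rho> x (w b) = b" by metis
  obtain y where y: "\<And>u. \<rho> y u = (\<Sum>b\<in>B. scale (q b u) (w b))"
    using rep_surj[of B q w] q(1) by blast
  have "\<rho> (x * y * x) u = \<rho> x u" for u
    using q(3)[of "\<rho> x u"] B(3) w by (simp add: rep_mult y T.sum T.scale)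
  then show ?thesis by (blast intro: rep_eqI)
qed

text \<open>An element x of the corner maps the image of \<open>e\<close> to itself and, since x = x
  e, is determined by its restriction there. This image is finite-dimensional, and dual functionals
  in \<open>P\<close> turn the restrictions into matrices, all of which occur.\<close>

lemma corner_matrix_algebra:
  assumes idem: "e * e = e" and "e \<noteq> 0"
  shows "fd_matrix_algebra scale_R (corner e)"
proof -
  obtain B where B: "finite B" "independent B" "span B = range (\<rho> e)"
    by (rule rep_range_basis)
  obtain q where q: "\<And>b. b \<in> B \<Longrightarrow> q b \<in> P"
    "\<And>b c. b \<in> B \<Longrightarrow> c \<in> B \<Longrightarrow> q b c = (if b = c then 1 else 0)"
    "\<And>v. v \<in> span B \<Longrightarrow> (\<Sum>b\<in>B. scale (q b v) b) = v"
    using dual_basis[OF B(1,2)] by blast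
  define n where "n = card B"
  obtain h where h: "bij_betw h {0..<n} B"
    using ex_bij_betw_nat_finite[OF B(1)] unfolding n_def by blast
  have hB: "h i \<in> B" if "i < n" for i using h that by (auto simp: bij_betw_def)
  have hh: "h i = h j \<longleftrightarrow> i = j" if "i < n" "j < n" for i j
    using h that by (auto simp: bij_betw_def inj_on_def)
  have sumB: "(\<Sum>b\<in>B. g b) = (\<Sum>i = 0..<n. g (h i))" for g :: "'v \<Rightarrow> 'v"
    using sum.reindex_bij_betw[OF h, of g] by simp
  have "B \<noteq> {}"
  proof
    assume "B = {}"
    then have "\<rho> e v = 0" for v using B(3) by auto
    moreover have "\<rho> 0 v = 0" for v using rep_add[of 0 0 v] by simp
    ultimately show False using \<open>e \<noteq> 0\<close> rep_eqI[of e 0] by simp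
  qed
  then have n: "n \<ge> 1" using B(1) by (simp add: n_def card_gt_0_iff Suc_le_eq)
  have eB: "\<rho> e b = b" if "b \<in> span B" for b
  proof -
    have "b \<in> range (\<rho> e)" using that by (simp only: B(3))
    then obtain v where v: "b = \<rho> e v" by (rule rangeE)
    show ?thesis using rep_mult[of e e v] unfolding v idem by (rule sym)
  qed
  have rep_range: "\<rho> x v \<in> span B" if "x \<in> corner e" for x v
  proof -
    have x: "e * x = x" using that by (simp add: corner_def)
    show ?thesis using rep_mult[of e x v] unfolding x B(3) by (rule range_eqI)
  qed
  have rep_corner: "\<rho> x (\<rho> e v) = \<rho> x v" if "x \<in> corner e" for x v
  proof -
    have x: "x * e = x" using that by (simp add: corner_def)
    show ?thesis using rep_mult[of x e v] unfolding x by (rule sym)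
  qed
  \<comment> \<open>The matrix of \<open>x\<close> on the image of \<open>e\<close> in the basis
    \<open>h\<close>: column \<open>j\<close> lists the coordinates of the vector to which
    \<open>x\<close> sends \<open>h j\<close>.\<close>
  define M where "M x = mat n n (\<lambda>(i, j). q (h i) (\<rho> x (h j)))" for x
  have expand: "v = (\<Sum>i = 0..<n. scale (q (h i) v) (h i))" if "v \<in> span B" for v
    using q(3)[OF that] by (simp add: sumB)
  have inj: "inj_on M (corner e)"
  proof
    fix x y assume xy: "x \<in> corner e" "y \<in> corner e" "M x = M y"
    interpret x: Vector_Spaces.linear scale scale "\<rho> x" by (rule rep_linear)
    interpret y: Vector_Spaces.linear scale scale "\<rho> y" by (rule rep_linear)
    have coeff_eq: "q (h i) (\<rho> x (h j)) = q (h i) (\<rho> y (h j))" if "i < n" "j < n" for i j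
      using arg_cong[OF xy(3), of "\<lambda>M. M $$ (i, j)"] that by (simp add: M_def)
    have eq: "\<rho> x (h j) = \<rho> y (h j)" if "j < n" for j
    proof -
      have "\<rho> x (h j) = (\<Sum>i = 0..<n. scale (q (h i) (\<rho> x (h j))) (h i))"
        by (rule expand[OF rep_range[OF xy(1)]])
      also have "\<dots> = (\<Sum>i = 0..<n. scale (q (h i) (\<rho> y (h j))) (h i))"
        using that by (intro sum.cong) (simp_all add: coeff_eq)
      also have "\<dots> = \<rho> y (h j)"
        by (rule expand[OF rep_range[OF xy(2)], symmetric])
      finally show ?thesis .
    qed
    have span_eq: "\<rho> x v = \<rho> y v" if "v \<in> span B" for v
    proof -
      define c where "c i = q (h i) v" for i
      have v: "v = (\<Sum>i = 0..<n. scale (c i) (h i))" using expand[OF that] by (simp only: c_def)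
      show ?thesis by (simp add: v x.sum y.sum x.scale y.scale eq)
    qed
    have "\<rho> x v = \<rho> y v" for v
      using span_eq[of "\<rho> e v"] rep_corner[OF xy(1), of v] rep_corner[OF xy(2), of v] B(3) by simp
    then show "x = y" by (rule rep_eqI)
  qed
  have surj: "N \<in> M ` corner e" if N: "N \<in> carrier_mat n n" for N
  proof -
    have coeff: "dual_scale (N $$ k) (q (h (snd k))) \<in> P" if "k \<in> {0..<n} \<times> {0..<n}" for k
      using that q(1) hB by (intro dual.subspace_scale[OF subspace_dual]) auto
    \<comment> \<open>The sum over (i, j) of N(i, j) times the operator w \<mapsto> q (h j) w h i,
      with matrix \<open>N\<close> on \<open>span B\<close>. The functionals are not controlled
      outside that span, so r e may differ from \<open>r\<close>; passing to r e enters the corner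
      and keeps the matrix, as \<open>e\<close> fixes the basis.\<close>
    obtain r where r: "\<And>w. \<rho> r w = (\<Sum>k\<in>{0..<n}\<times>{0..<n}.
        scale (dual_scale (N $$ k) (q (h (snd k))) w) (h (fst k)))"
      using rep_surj[of "{0..<n}\<times>{0..<n}" "\<lambda>k. dual_scale (N $$ k) (q (h (snd k)))" "\<lambda>k. h (fst k)",
          OF coeff] by blast
    have r_span: "\<rho> r w \<in> span B" for w
      unfolding r by (intro span_sum span_scale span_base[OF hB]) auto
    have er: "e * r = r" by (rule rep_eqI) (simp add: rep_mult eB r_span)
    have corner: "r * e \<in> corner e"
      using arg_cong[OF er, of "\<lambda>u. u * e"] by (simp add: corner_def idem mult.assoc)
    have "M (r * e) = N"
    proof (rule eq_matI)
      fix i j assume "i < dim_row N" "j < dim_col N"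
      then have ij: "i < n" "j < n" using N by auto
      have "\<rho> r (h j) = (\<Sum>a = 0..<n. \<Sum>b = 0..<n. scale (N $$ (a, b) * q (h b) (h j)) (h a))"
        by (simp only: r dual_scale_def case_prod_unfold sum.cartesian_product prod.collapse)
      also have "\<dots> = (\<Sum>a = 0..<n. \<Sum>b = 0..<n. if b = j then scale (N $$ (a, j)) (h a) else 0)"
        using ij by (intro sum.cong) (auto simp: q(2) hB hh)
      also have "\<dots> = (\<Sum>a = 0..<n. scale (N $$ (a, j)) (h a))"
        using ij by simp
      finally have "q (h i) (\<rho> r (h j)) = (\<Sum>a = 0..<n. N $$ (a, j) * q (h i) (h a))"
        using q(1)[OF hB[OF ij(1)]] by (simp only: functional_sum functional_scale)
      also have "\<dots> = (\<Sum>a = 0..<n. if a = i then N $$ (i, j) else 0)"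
        using ij by (intro sum.cong) (auto simp: q(2) hB hh)
      finally show "M (r * e) $$ (i, j) = N $$ (i, j)"
        using ij hB by (simp add: M_def rep_mult eB span_base)
    qed (use N in \<open>auto simp: M_def\<close>)
    then show ?thesis using corner by blast
  qed
  have mult: "M (x * y) = M x * M y" if "x \<in> corner e" "y \<in> corner e" for x y
  proof (rule eq_matI)
    fix i j assume "i < dim_row (M x * M y)" "j < dim_col (M x * M y)"
    then have ij: "i < n" "j < n" by (auto simp: M_def)
    interpret x: Vector_Spaces.linear scale scale "\<rho> x" by (rule rep_linear)
    have "\<rho> x (\<rho> y (h j)) = (\<Sum>k = 0..<n. scale (q (h k) (\<rho> y (h j))) (\<rho> x (h k)))"
    proof -
      define c where "c k = q (h k) (\<rho> y (h j))" for k
      have v: "\<rho> y (h j) = (\<Sum>k = 0..<n. scale (c k) (h k))"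
        using expand[OF rep_range[OF that(2)]] by (simp only: c_def)
      have "\<rho> x (\<rho> y (h j)) = (\<Sum>k = 0..<n. scale (c k) (\<rho> x (h k)))"
        by (simp only: v x.sum x.scale)
      then show ?thesis by (simp only: c_def)
    qed
    then show "M (x * y) $$ (i, j) = (M x * M y) $$ (i, j)"
      using ij q(1)[OF hB[OF ij(1)]]
      by (simp add: M_def rep_mult scalar_prod_def functional_sum functional_scale mult.commute)
  qed (auto simp: M_def)
  have add: "M (x + y) = M x + M y" for x y
    by (rule eq_matI) (auto simp: M_def rep_add functional_add q(1) hB)
  have scale: "M (scale_R c x) = c \<cdot>\<^sub>m M x" for c x
    by (rule eq_matI) (auto simp: M_def rep_scale functional_scale q(1) hB)
  have "bij_betw M (corner e) (carrier_mat n n)"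
    using inj surj by (auto simp: bij_betw_def M_def)
  then show ?thesis
    unfolding fd_matrix_algebra_def alg_isomorphic_def alg_on_def mat_alg_def algebra_struct.simps
    using n mult add scale by (intro exI[of _ n] exI[of _ M] conjI ballI allI)
qed

end

section \<open>Transporting the abstract isomorphism to operators\<close>

text \<open>Choose a representative \<open>t x\<close> of each coset \<open>\<phi> x\<close>. Its
  action depends only on the coset, so the homomorphism laws of \<open>\<phi>\<close> become
  identities between operators, and bijectivity gives faithfulness and the full image.\<close>

lemma (in dual_pair) representation_exists:
  assumes "assoc_algebra scale_R"
    and "alg_isomorphic (alg_on scale_R UNIV) (tensor_alg scale P)"
  obtains \<rho> where "finite_rank_representation scale P scale_R \<rho>"
proof -
  interpret R: assoc_algebra scale_R by fact
  let ?C = "tensor_class scale P" and ?T = "tensor_alg scale P"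
  obtain \<phi> where bij: "bij_betw \<phi> UNIV (?C ` free_space P)"
    and hom: "\<And>x y. \<phi> (x + y) = alg_add ?T (\<phi> x) (\<phi> y)"
      "\<And>x y. \<phi> (x * y) = alg_mult ?T (\<phi> x) (\<phi> y)"
      "\<And>c x. \<phi> (scale_R c x) = alg_scale ?T c (\<phi> x)"
    using assms(2) unfolding alg_isomorphic_def by (auto simp: alg_on_def tensor_alg_def)
  have "\<exists>t. t \<in> free_space P \<and> \<phi> x = ?C t" for x
    using bij_betwE[OF bij, rule_format, OF UNIV_I, of x] by blast
  then obtain t where t: "\<And>x. t x \<in> free_space P" "\<And>x. \<phi> x = ?C (t x)"
    by metis
  have act_t: "act (t x) = act u" if "\<phi> x = ?C u" "u \<in> free_space P" for x u
    using that t tensor_class_eq_iff by metis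
  have "finite_rank_representation scale P scale_R (\<lambda>x. act (t x))"
  proof
    fix x y v c
    note ops = tensor_alg_ops[OF t(1) t(1)]
    have "\<phi> (x + y) = ?C (t x + t y)" by (simp only: hom(1) t(2)[of x] t(2)[of y] ops)
    from act_t[OF this free.subspace_add[OF subspace_free_space t(1) t(1)]]
    show "act (t (x + y)) v = act (t x) v + act (t y) v" by (simp only: act_add)
    have "\<phi> (x * y) = ?C (free_mult (t x) (t y))" by (simp only: hom(2) t(2)[of x] t(2)[of y] ops)
    from act_t[OF this free_mult_closed[OF t(1)]]
    show "act (t (x * y)) v = act (t x) (act (t y) v)" by (simp only: act_mult[OF t(1)])
    have "\<phi> (scale_R c x) = ?C (free_scale c (t x))" by (simp only: hom(3) t(2)[of x] ops)
    from act_t[OF this free.subspace_scale[OF subspace_free_space t(1)]]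
    show "act (t (scale_R c x)) v = scale c (act (t x) v)" by (simp only: act_scale)
  next
    show "inj (\<lambda>x. act (t x))"
    proof (rule injI)
      fix x y assume "act (t x) = act (t y)"
      then have "\<phi> x = \<phi> y"
        unfolding t(2) by (simp only: tensor_class_eq_iff t(1))
      then show "x = y" using bij by (simp add: bij_betw_def inj_eq)
    qed
    show "range (\<lambda>x. act (t x)) = act ` free_space P"
    proof (intro subset_antisym subsetI)
      fix f assume "f \<in> act ` free_space P"
      then obtain u where u: "u \<in> free_space P" "f = act u" by blast
      then have "?C u \<in> range \<phi>" using bij by (simp add: bij_betw_def)
      then obtain x where "?C u = \<phi> x" by (rule rangeE)
      from act_t[OF this[symmetric] u(1)] show "f \<in> range (\<lambda>x. act (t x))"
        unfolding u(2) by (rule range_eqI[OF sym])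
    next
      fix f assume "f \<in> range (\<lambda>x. act (t x))"
      then show "f \<in> act ` free_space P" using t(1) by (auto intro: imageI)
    qed
  qed
  then show ?thesis using that by blast
qed

text \<open>A functional in \<open>P\<close> with p v \<noteq> 0 gives the nonzero operator w
  \<mapsto> p(w) v. The nonzero element serves to keep a local unit from being zero.\<close>

lemma (in finite_rank_representation) nontrivial: "\<exists>x::'r. x \<noteq> 0"
proof -
  obtain v :: 'v where "v \<noteq> 0"
    using mutually_dual by (auto simp: mutually_dual_spaces_def)
  then obtain p where p: "p \<in> P" "p v \<noteq> 0"
    using nondegenerate by blast
  obtain x where x: "\<And>w. \<rho> x w = (\<Sum>i\<in>{()}. scale (p w) v)"
    using rep_surj[of "{()}" "\<lambda>_. p" "\<lambda>_. v"] p(1) by blast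
  have "\<rho> x v \<noteq> 0" using p(2) \<open>v \<noteq> 0\<close> by (simp add: x)
  moreover have "\<rho> 0 v = 0" using rep_add[of 0 0 v] by simp
  ultimately have "x \<noteq> 0" by (intro notI) simp
  then show ?thesis ..
qed

section \<open>Graded corners and the local system they form\<close>

lemma graded_regular_gradingI:
  assumes "assoc_algebra scale" and "grading scale A" and regular: "\<And>x::'r::ring. \<exists>y. x * y * x = x"
  shows "graded_regular ((*) :: 'r \<Rightarrow> _) A"
proof -
  interpret assoc_algebra scale by fact
  have sub: "subspace (A g)" for g
    using assms(2) by (simp add: grading_def internal_direct_sum_def)
  show ?thesis
  proof
    show "\<exists>!c. (\<forall>g. c g \<in> A g) \<and> x = (\<Sum>g\<in>UNIV. c g)" for x
      using assms(2) by (simp add: grading_def internal_direct_sum_def)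
    show "x * y \<in> A (g + h)" if "x \<in> A g" "y \<in> A h" for x y g h
      using assms(2) that by (simp add: grading_def)
    show "\<exists>y. x * y * x = x" for x :: 'r
      by (rule regular)
  qed (simp_all add: mult.assoc distrib_left distrib_right subspace_0 subspace_diff sub)
qed

text \<open>Multiplication by \<open>e\<close> on either side commutes with taking components, so
  components of an element of the corner stay in the corner. Uniqueness is inherited from the
  grading of the whole algebra.\<close>

lemma graded_corner:
  assumes "assoc_algebra scale" and "grading scale A" and "graded_regular (*) A" and e: "e \<in> A 0"
  shows "graded_subalgebra scale A (corner e)"
proof -
  interpret assoc_algebra scale by fact
  interpret G: graded_regular "(*)" A by fact
  have sub: "subspace (A g)" for g
    using assms(2) by (simp add: grading_def internal_direct_sum_def)
  have corner: "subspace (corner e)"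
    by (rule subspaceI) (auto simp: corner_def distrib_left distrib_right scale_mult_left scale_mult_right)
  have mult: "x * y \<in> corner e" if "x \<in> corner e" "y \<in> corner e" for x y
  proof -
    have "e * (x * y) = e * x * y" and "x * y * e = x * (y * e)" by (simp_all only: mult.assoc)
    then show ?thesis using that by (simp add: corner_def)
  qed
  have component: "G.component w g \<in> corner e" if "w \<in> corner e" for w g
    using G.component_mult_left[OF e, of w g] G.component_mult_right[OF e, of w g] that
    by (simp add: corner_def)
  have "\<exists>!f. (\<forall>g. f g \<in> corner e \<inter> A g) \<and> w = (\<Sum>g\<in>UNIV. f g)" if "w \<in> corner e" for w
  proof (rule ex1I)
    show "(\<forall>g. G.component w g \<in> corner e \<inter> A g) \<and> w = (\<Sum>g\<in>UNIV. G.component w g)"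
      using component[OF that] G.component_closed G.sum_component by simp
    show "f = G.component w" if "(\<forall>g. f g \<in> corner e \<inter> A g) \<and> w = (\<Sum>g\<in>UNIV. f g)" for f
      using that by (intro G.component_eqI[symmetric]) auto
  qed
  then show ?thesis
    using corner mult sub subspace_inter[OF corner sub]
    by (simp add: graded_subalgebra_def subalgebra_def internal_direct_sum_def)
qed

theorem theorem4:
  fixes scale_R :: "'f::{alg_closed_field, field_char_0} \<Rightarrow> 'r::ring \<Rightarrow> 'r"
    and scale_V :: "'f \<Rightarrow> 'v::ab_group_add \<Rightarrow> 'v"
    and P :: "('v \<Rightarrow> 'f) set"
    and A :: "'g::{ab_group_add, finite} \<Rightarrow> 'r set"
  assumes "assoc_algebra scale_R"
    and "mutually_dual_spaces scale_V P"
    and "alg_isomorphic (alg_on scale_R UNIV) (tensor_alg scale_V P)"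
    and "grading scale_R A"
  shows "\<exists>(I :: 'r set set) leq S.
           local_system scale_R I leq S \<and>
           (\<forall>a\<in>I. graded_subalgebra scale_R A (S a) \<and> fd_matrix_algebra scale_R (S a))"
proof -
  interpret dual_pair scale_V P by unfold_locales fact
  obtain \<rho> where "finite_rank_representation scale_V P scale_R \<rho>"
    using representation_exists[OF assms(1,3)] by blast
  then interpret finite_rank_representation scale_V P scale_R \<rho> .
  have "graded_regular (*) A"
    using assms(1,4) regular by (rule graded_regular_gradingI)
  then interpret G: graded_regular "(*)" A .
  \<comment> \<open>Zero is excluded because its corner is the zero algebra, while matrix algebras
    have size at least 1.\<close>
  define E where "E = {e \<in> A 0. e * e = e \<and> e \<noteq> 0}"
  have graded: "graded_subalgebra scale_R A (corner e)" if "e \<in> E" for e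
    using that assms(1,4) \<open>graded_regular (*) A\<close> by (intro graded_corner) (simp_all add: E_def)
  have matrix: "fd_matrix_algebra scale_R (corner e)" if "e \<in> E" for e
    using that by (intro corner_matrix_algebra) (simp_all add: E_def)
  have upper: "\<exists>e\<in>E. corner a \<subseteq> corner e \<and> corner b \<subseteq> corner e" if "a \<in> E" "b \<in> E" for a b
  proof -
    have ab: "a \<in> A 0" "b \<in> A 0" "a \<noteq> 0" using that by (simp_all add: E_def)
    have sub: "{a, b} \<subseteq> (\<Union>g. A g)" using ab by blast
    \<comment> \<open>A common local unit of \<open>a\<close> and \<open>b\<close>. If e c = c = c
      e, then \<open>e\<close> fixes every element of the corner of c on both sides; and
      \<open>e\<close> is nonzero because it fixes the nonzero \<open>a\<close>.\<close>
    obtain e where e: "e \<in> A 0" "e * e = e" "\<And>x. x \<in> {a, b} \<Longrightarrow> e * x = x \<and> x * e = x"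
      using G.local_unit_degree_zero[OF _ sub] by blast
    have "corner c \<subseteq> corner e" if "c \<in> {a, b}" for c
    proof
      fix x assume "x \<in> corner c"
      then have x: "c * x = x" "x * c = x" by (simp_all add: corner_def)
      have c: "e * c = c" "c * e = c" using e(3)[OF that] by blast+
      have "e * (c * x) = c * x" by (simp only: c mult.assoc[symmetric])
      moreover have "x * c * e = x * c" by (simp only: c mult.assoc)
      ultimately show "x \<in> corner e" by (simp only: corner_def x mem_Collect_eq)
    qed
    moreover have "e \<noteq> 0" using e(3)[of a] ab(3) by auto
    then have "e \<in> E" using e(1,2) by (simp add: E_def)
    ultimately show ?thesis by blast
  qed
  have cover: "\<exists>e\<in>E. x \<in> corner e" for x
  proof -
    \<comment> \<open>The components of a nonzero \<open>z\<close> are added so that the local unit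
      is nonzero even when \<open>x\<close> is zero.\<close>
    obtain z :: 'r where "z \<noteq> 0" using nontrivial by blast
    let ?X = "range (G.component x) \<union> range (G.component z)"
    have fin: "finite ?X" by simp
    have sub: "?X \<subseteq> (\<Union>g. A g)" using G.component_closed by blast
    obtain e where e: "e \<in> A 0" "e * e = e" "\<And>u. u \<in> ?X \<Longrightarrow> e * u = u \<and> u * e = u"
      using G.local_unit_degree_zero[OF fin sub] by blast
    have unit: "e * y = y \<and> y * e = y" if "range (G.component y) \<subseteq> ?X" for y
    proof -
      have "G.component y g \<in> ?X" for g using that by (rule subsetD) (rule rangeI)
      note c = this[THEN e(3), THEN conjunct1] this[THEN e(3), THEN conjunct2]
      have "e * (\<Sum>g\<in>UNIV. G.component y g) = (\<Sum>g\<in>UNIV. G.component y g)"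
        and "(\<Sum>g\<in>UNIV. G.component y g) * e = (\<Sum>g\<in>UNIV. G.component y g)"
        by (simp_all only: sum_distrib_left sum_distrib_right c)
      then show ?thesis by (simp add: G.sum_component)
    qed
    have "e \<noteq> 0" using unit[of z] \<open>z \<noteq> 0\<close> by auto
    then have "e \<in> E" using e(1,2) by (simp add: E_def)
    then show ?thesis using unit[of x] by (auto simp: corner_def)
  qed
  have bound: "\<exists>c\<in>corner ` E. a \<subseteq> c \<and> b \<subseteq> c" if ab: "a \<in> corner ` E" "b \<in> corner ` E" for a b
  proof -
    obtain a' b' where a: "a = corner a'" "a' \<in> E" and b: "b = corner b'" "b' \<in> E"
      using ab by (elim imageE)
    show ?thesis
      using upper[OF a(2) b(2)] unfolding a(1) b(1) by (simp add: bex_simps)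
  qed
  have "corner ` E \<noteq> {}" using cover[of 0] by auto
  then have directed: "directed_set (corner ` E) (\<subseteq>)"
    unfolding directed_set_def by (intro conjI ballI impI bound) (simp_all add: subset_trans)
  have "(\<Union>a\<in>corner ` E. a) = UNIV" using cover by auto
  \<comment> \<open>The corners serve as their own index set, ordered by inclusion, with the
    identity map as the family.\<close>
  then have "local_system scale_R (corner ` E) (\<subseteq>) (\<lambda>W. W)"
    unfolding local_system_def using graded
    by (intro conjI ballI bound directed) (auto simp: graded_subalgebra_def)
  moreover have "\<forall>a\<in>corner ` E. graded_subalgebra scale_R A a \<and> fd_matrix_algebra scale_R a"
    using graded matrix by simp
  ultimately show ?thesis
    by (intro exI[of _ "corner ` E"] exI[of _ "(\<subseteq>)"] exI[of _ "\<lambda>W. W"] conjI)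
qed

end
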